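(* Let $N\geq 2$ be a fixed integer, and let $(a_n)_{n\ge0}$ be the sequence defined by $a_{N^j}=\frac{1}{N^{j/2}}$ for every integer $j\geq 1$, and $a_n=0$ for all other values of $n$. Let $C=C[a_n]$ be the infinite lower triangular matrix with entries $C_{ij}=a_i$ if $0\le j\leq i$ and $C_{ij}=0$ if $j>i$, where $i,j\in\{0,1,2,\dots\}$. Then $$\|C\|_{\ell^2\to\ell^2}=\frac{\sqrt{N-1}}{\sqrt{N}-1}.$$
   Context: Matrix and sequence indices start from $0$. For a sequence $(a_n)_{n\ge0}$, the $C$-matrix $C[a_n]$ (also called a terraced matrix) is the lower triangular infinite matrix whose $i$-th row has the constant value $a_i$ in columns $0,\dots,i$ and zeros afterwards. It acts on sequences $x=(x_j)_{j\ge0}$ by $(Cx)_i=\sum_{j\ge0}C_{ij}x_j=a_i\sum_{j=0}^{i}x_j$, and $\|C\|_{\ell^2\to\ell^2}=\sup_{x\neq0}\|Cx\|_2/\|x\|_2$ is its operator norm on $\ell^2$ (square-summable sequences indexed by $\{0,1,2,\dots\}$). *)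

theory Defs
  imports "HOL-Analysis.Analysis"
begin

definition C_matrix :: "(nat \<Rightarrow> real) \<Rightarrow> nat \<Rightarrow> nat \<Rightarrow> real" where
  "C_matrix a i j = (if j \<le> i then a i else 0)"

text \<open>The scalar field is any \<open>real_normed_field\<close>, so both real and complex sequences are
  covered. For a general matrix \<open>matrix_action\<close> is meaningful only when the series converge; the
  rows of a lower triangular matrix are finitely supported, so there it is no restriction.\<close>

definition matrix_action ::
    "(nat \<Rightarrow> nat \<Rightarrow> real) \<Rightarrow> (nat \<Rightarrow> 'k::real_normed_field) \<Rightarrow> nat \<Rightarrow> 'k" where
  "matrix_action A x i = (\<Sum>j. A i j *\<^sub>R x j)"

definition ell2 :: "(nat \<Rightarrow> 'k::real_normed_field) set" where
  "ell2 = {x. summable (\<lambda>j. (norm (x j))\<^sup>2)}"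

text \<open>The norms are extended real numbers: a sequence outside \<open>ell2\<close> has norm \<open>\<infinity>\<close>, and
  so has an operator that is unbounded or does not map \<open>ell2\<close> into itself. A finite value of
  \<open>ell2_opnorm\<close> therefore includes boundedness on \<open>ell2\<close>.\<close>

definition ell2_norm :: "(nat \<Rightarrow> 'k::real_normed_field) \<Rightarrow> ereal" where
  "ell2_norm x = (if x \<in> ell2 then ereal (sqrt (\<Sum>j. (norm (x j))\<^sup>2)) else \<infinity>)"

definition ell2_opnorm ::
    "((nat \<Rightarrow> 'k::real_normed_field) \<Rightarrow> nat \<Rightarrow> 'k) \<Rightarrow> ereal" where
  "ell2_opnorm T = (SUP x \<in> ell2 - {\<lambda>_. 0}. ell2_norm (T x) / ell2_norm x)"

end

theory Submission
  imports Defs "HOL-Real_Asymp.Real_Asymp"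
begin

text \<open>Put \<open>s = sqrt N\<close> and \<open>r = 1 / s\<close>. The image \<open>C x\<close> lives on the indices \<open>N ^ k\<close> with
  \<open>k \<ge> 1\<close>; let \<open>u\<^sub>k\<close> be the absolute value of its entry there. Let \<open>E\<^sub>k\<close> be the energy, i.e. the
  sum of \<open>\<bar>x\<^sub>i\<bar>\<^sup>2\<close>, over the indices that the row \<open>N ^ k\<close> meets and the earlier nonzero rows do not:
  the block \<open>N ^ (k-1) < i \<le> N ^ k\<close> if \<open>k \<ge> 2\<close>, and \<open>{0..N}\<close> if \<open>k = 1\<close>. The claimed norm squared is
  \<open>(N - 1) / (s - 1)\<^sup>2 = (s + 1) / (s - 1) = (1 + r) / (1 - r)\<close>.

  For the upper bound, passing from \<open>N ^ k\<close> to \<open>N ^ (k+1)\<close> multiplies the old entry by \<open>r\<close> and adds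
  the contribution of one block of \<open>N ^ k * (N - 1)\<close> indices. Convexity of the square with weights
  \<open>r\<close> and \<open>1 - r\<close>, together with Cauchy-Schwarz on the block, gives
  \<open>u\<^sub>k\<^sub>+\<^sub>1\<^sup>2 \<le> r * u\<^sub>k\<^sup>2 + (1 + r) * E\<^sub>k\<^sub>+\<^sub>1\<close>
  (lemma \<open>C_step\<close>). The initial set \<open>{0..N}\<close> has \<open>N + 1\<close> elements, which is two more than the
  pattern of the later blocks would suggest, but Cauchy-Schwarz still yields
  \<open>u\<^sub>1\<^sup>2 \<le> (1 + r\<^sup>2) * E\<^sub>1 \<le> (1 + r) * E\<^sub>1\<close> (lemma \<open>C_first\<close>). Summing these recursive inequalities gives
  \<open>(1 - r) * \<Sum> u\<^sub>k\<^sup>2 \<le> (1 + r) * \<Sum> \<bar>x\<^sub>i\<bar>\<^sup>2\<close>.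

  For the lower bound, convexity and Cauchy-Schwarz are nearly sharp when \<open>x\<close> is constant on blocks and
  \<open>u\<^sub>k\<close> does not depend on \<open>k\<close>. A sequence of this kind cut off after \<open>n\<close> blocks has
  \<open>u\<^sub>1 = \<dots> = u\<^sub>n = 1\<close> and energy \<open>1 + n * (1 - r) / (1 + r)\<close>, so the squared quotient is at least
  \<open>n / (1 + n * (1 - r) / (1 + r))\<close>, which tends to \<open>(1 + r) / (1 - r)\<close>
  (lemmas \<open>opnorm_ge_quotient\<close> and \<open>opnorm_ge\<close>).\<close>

section \<open>Preliminaries\<close>

lemma matrix_action_C_matrix:
  fixes x :: "nat \<Rightarrow> 'k::real_normed_field"
  shows "matrix_action (C_matrix a) x i = a i *\<^sub>R (\<Sum>j\<le>i. x j)"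
proof -
  have "matrix_action (C_matrix a) x i = (\<Sum>j\<le>i. C_matrix a i j *\<^sub>R x j)"
    unfolding matrix_action_def by (rule suminf_finite) (auto simp: C_matrix_def)
  also have "\<dots> = a i *\<^sub>R (\<Sum>j\<le>i. x j)"
    by (simp add: C_matrix_def scaleR_sum_right)
  finally show ?thesis .
qed

lemma norm_sum_squared_le:
  fixes x :: "'b \<Rightarrow> 'k::real_normed_vector"
  shows "(norm (\<Sum>i\<in>A. x i))\<^sup>2 \<le> real (card A) * (\<Sum>i\<in>A. (norm (x i))\<^sup>2)"
proof -
  have "(norm (\<Sum>i\<in>A. x i))\<^sup>2 \<le> (\<Sum>i\<in>A. norm (x i))\<^sup>2"
    by (intro power_mono norm_sum) auto
  also have "\<dots> \<le> (\<Sum>i\<in>A. (norm (x i))\<^sup>2) * real (card A)"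
    by (rule sum_squared_le_sum_of_squares)
  finally show ?thesis by (simp add: mult.commute)
qed

text \<open>This is convexity of the square at the points \<open>p\<close> and \<open>q / (1 - r)\<close>, with weights \<open>r\<close> and
  \<open>1 - r\<close>. The factor \<open>r\<close> survives in front of \<open>p\<^sup>2\<close>, so that iterating the estimate loses only a
  geometric series.\<close>

lemma weighted_square_le:
  fixes r p q :: real
  assumes "0 \<le> r" "r < 1"
  shows "(r * p + q)\<^sup>2 \<le> r * p\<^sup>2 + q\<^sup>2 / (1 - r)"
proof -
  have "r * p\<^sup>2 + q\<^sup>2 / (1 - r) - (r * p + q)\<^sup>2 = r / (1 - r) * ((1 - r) * p - q)\<^sup>2"
    using assms by (simp add: field_simps power2_eq_square)
  moreover have "0 \<le> r / (1 - r) * ((1 - r) * p - q)\<^sup>2"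
    using assms by simp
  ultimately show ?thesis by linarith
qed

lemma suminf_norm_pos:
  fixes x :: "nat \<Rightarrow> 'k::real_normed_field"
  assumes "x \<in> ell2 - {\<lambda>_. 0}"
  shows "0 < (\<Sum>j. (norm (x j))\<^sup>2)"
proof -
  obtain i where "x i \<noteq> 0" using assms by auto
  then show ?thesis
    using assms by (intro suminf_pos2[of _ i]) (auto simp: ell2_def)
qed

text \<open>The extended-real quotients in the operator norm are ordinary real quotients as soon as
  the image sequence is square summable; this is the bridge to inequalities between real sums.\<close>

lemma ell2_norm_quotient:
  fixes x y :: "nat \<Rightarrow> 'k::real_normed_field"
  assumes "x \<in> ell2 - {\<lambda>_. 0}" "y \<in> ell2"
  shows "ell2_norm y / ell2_norm x =
    ereal (sqrt ((\<Sum>j. (norm (y j))\<^sup>2) / (\<Sum>j. (norm (x j))\<^sup>2)))"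
  using assms suminf_norm_pos[OF assms(1)] by (simp add: ell2_norm_def real_sqrt_divide)

section \<open>Upper bound\<close>

locale geometric_terraced =
  fixes N :: nat and a :: "nat \<Rightarrow> real"
  assumes N_ge_2: "2 \<le> N"
    and entry: "a (N ^ Suc j) = 1 / sqrt (real N) ^ Suc j"
    and entry_off: "n \<notin> range (\<lambda>j. N ^ Suc j) \<Longrightarrow> a n = 0"
begin

definition s :: real where "s = sqrt (real N)"

abbreviation C :: "(nat \<Rightarrow> 'k::real_normed_field) \<Rightarrow> nat \<Rightarrow> 'k" where
  "C \<equiv> matrix_action (C_matrix a)"

lemma s_gt_1: "1 < s"
  using N_ge_2 by (simp add: s_def)

lemma s_power2: "s\<^sup>2 = real N"
  by (simp add: s_def)

lemma entry_s: "a (N ^ Suc j) = 1 / s ^ Suc j"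
  unfolding s_def by (rule entry)

lemma s_power_square: "(s ^ k)\<^sup>2 = real (N ^ k)"
  by (simp add: power_mult[symmetric] mult.commute[of k]) (simp add: power_mult s_power2)

lemma strict_mono_pow: "strict_mono (\<lambda>j. N ^ Suc j)"
  using N_ge_2 by (intro strict_monoI power_strict_increasing) auto

lemma norm_C_pow:
  fixes x :: "nat \<Rightarrow> 'k::real_normed_field"
  shows "norm (C x (N ^ Suc j)) = norm (\<Sum>i\<le>N ^ Suc j. x i) / s ^ Suc j"
  using s_gt_1 by (simp only: matrix_action_C_matrix entry_s norm_scaleR) (simp add: field_simps)

lemma sum_upto_pow_Suc:
  fixes f :: "nat \<Rightarrow> 'b::comm_monoid_add"
  shows "(\<Sum>i\<le>N ^ Suc k. f i) = (\<Sum>i\<le>N ^ k. f i) + (\<Sum>i\<in>{N ^ k<..N ^ Suc k}. f i)"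
proof -
  have "N ^ k \<le> N ^ Suc k" using N_ge_2 by simp
  then have "{..N ^ Suc k} = {..N ^ k} \<union> {N ^ k<..N ^ Suc k}"
    by (simp only: ivl_disj_un_one)
  then show ?thesis by (simp only:) (rule sum.union_disjoint, auto)
qed

lemma card_block: "real (card {N ^ k<..N ^ Suc k}) = (s ^ k)\<^sup>2 * (real N - 1)"
proof -
  have "N ^ k \<le> N ^ Suc k" using N_ge_2 by simp
  then have "real (card {N ^ k<..N ^ Suc k}) = real (N ^ Suc k) - real (N ^ k)"
    by (simp only: card_greaterThanAtMost of_nat_diff)
  then show ?thesis unfolding s_power_square by (simp add: algebra_simps)
qed

text \<open>The \<open>N + 1\<close> summands of the first entry cost a factor \<open>(N + 1) / N = 1 + 1 / s\<^sup>2\<close>. That this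
  does not exceed the factor \<open>1 + 1 / s\<close> of all later blocks is the reason why the oversized
  initial block does not influence the norm.\<close>

lemma C_first:
  fixes x :: "nat \<Rightarrow> 'k::real_normed_field"
  shows "(norm (C x (N ^ Suc 0)))\<^sup>2 \<le> (1 + 1 / s) * (\<Sum>i\<le>N ^ Suc 0. (norm (x i))\<^sup>2)"
proof -
  have "(norm (C x (N ^ Suc 0)))\<^sup>2 = (norm (\<Sum>i\<le>N. x i))\<^sup>2 / s\<^sup>2"
    by (simp only: norm_C_pow power_divide) simp
  also have "\<dots> \<le> (real N + 1) * (\<Sum>i\<le>N. (norm (x i))\<^sup>2) / s\<^sup>2"
    using norm_sum_squared_le[of x "{..N}"] by (intro divide_right_mono) (auto simp: add.commute)
  also have "\<dots> = (1 + 1 / s\<^sup>2) * (\<Sum>i\<le>N. (norm (x i))\<^sup>2)"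
    unfolding s_power2 using N_ge_2 by (simp add: field_simps)
  also have "\<dots> \<le> (1 + 1 / s) * (\<Sum>i\<le>N. (norm (x i))\<^sup>2)"
  proof -
    have "1 / s\<^sup>2 \<le> 1 / s"
      using s_gt_1 power_increasing[of 1 2 s] by (intro frac_le) simp_all
    then show ?thesis by (intro mult_right_mono sum_nonneg) auto
  qed
  finally show ?thesis by simp
qed

text \<open>The constant arises as the Cauchy-Schwarz factor \<open>N ^ (k+1) * (N - 1) / N ^ (k+2) = 1 - 1 / s\<^sup>2\<close>
  of the block divided by the convexity weight \<open>1 - 1 / s\<close>. It is independent of \<open>k\<close> because the
  block lengths grow at the rate at which the squared matrix entries decay.\<close>

lemma C_step:
  fixes x :: "nat \<Rightarrow> 'k::real_normed_field"
  shows "(norm (C x (N ^ Suc (Suc k))))\<^sup>2 \<le> 1 / s * (norm (C x (N ^ Suc k)))\<^sup>2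
    + (1 + 1 / s) * (\<Sum>i\<in>{N ^ Suc k<..N ^ Suc (Suc k)}. (norm (x i))\<^sup>2)"
proof -
  define B where "B = {N ^ Suc k<..N ^ Suc (Suc k)}"
  define q where "q = norm (\<Sum>i\<in>B. x i) / s ^ Suc (Suc k)"
  define E where "E = (\<Sum>i\<in>B. (norm (x i))\<^sup>2)"
  have s: "1 < s" by (rule s_gt_1)
  have "norm (C x (N ^ Suc (Suc k)))
      \<le> (norm (\<Sum>i\<le>N ^ Suc k. x i) + norm (\<Sum>i\<in>B. x i)) / s ^ Suc (Suc k)"
    unfolding norm_C_pow sum_upto_pow_Suc[of _ "Suc k"] B_def
    using s by (intro divide_right_mono norm_triangle_ineq) auto
  also have "\<dots> = 1 / s * norm (C x (N ^ Suc k)) + q"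
    unfolding norm_C_pow q_def using s by (simp add: field_simps)
  finally have "(norm (C x (N ^ Suc (Suc k))))\<^sup>2 \<le> (1 / s * norm (C x (N ^ Suc k)) + q)\<^sup>2"
    by (intro power_mono) auto
  also have "\<dots> \<le> 1 / s * (norm (C x (N ^ Suc k)))\<^sup>2 + q\<^sup>2 / (1 - 1 / s)"
    using s by (intro weighted_square_le) auto
  also have "q\<^sup>2 / (1 - 1 / s) \<le> (1 + 1 / s) * E"
  proof -
    have "q\<^sup>2 \<le> ((s ^ Suc k)\<^sup>2 * (real N - 1) * E) / (s ^ Suc (Suc k))\<^sup>2"
      using norm_sum_squared_le[of x B] card_block[of "Suc k"]
      unfolding q_def power_divide E_def B_def by (intro divide_right_mono) auto
    also have "\<dots> = (s\<^sup>2 - 1) / s\<^sup>2 * E"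
      unfolding s_power2[symmetric] power_Suc[of s "Suc k"] power_mult_distrib
      using s by (simp add: field_simps)
    also have "\<dots> = (1 + 1 / s) * E * (1 - 1 / s)"
      using s by (simp add: field_simps power2_eq_square)
    finally show ?thesis
      using s by (subst pos_divide_le_eq) simp_all
  qed
  finally show ?thesis unfolding E_def B_def by simp
qed

text \<open>The last entry is kept as an extra term with weight \<open>1 / s\<close>: it is exactly what the next
  application of the recursive inequality consumes, which makes the induction close.\<close>

lemma C_partial_sums:
  fixes x :: "nat \<Rightarrow> 'k::real_normed_field"
  shows "(1 - 1 / s) * (\<Sum>j\<le>n. (norm (C x (N ^ Suc j)))\<^sup>2) + 1 / s * (norm (C x (N ^ Suc n)))\<^sup>2
    \<le> (1 + 1 / s) * (\<Sum>i\<le>N ^ Suc n. (norm (x i))\<^sup>2)"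
proof (induction n)
  case 0
  show ?case using C_first[of x] by (simp add: algebra_simps)
next
  case (Suc n)
  show ?case
    using Suc.IH C_step[of x n]
    unfolding sum_upto_pow_Suc[of _ "Suc n"] sum.atMost_Suc distrib_left
    by (simp add: left_diff_distrib del: power_Suc)
qed

text \<open>The square of the norm; see \<open>sqrt_bound\<close> for the form \<open>sqrt (N - 1) / (s - 1)\<close> of its root.\<close>

definition bound :: real where "bound = (s + 1) / (s - 1)"

lemma bound_pos: "0 < bound"
  unfolding bound_def using s_gt_1 by (intro divide_pos_pos) simp_all

lemma C_eq_0_off_powers: "n \<notin> range (\<lambda>j. N ^ Suc j) \<Longrightarrow> (norm (C x n))\<^sup>2 = 0"
  by (simp add: matrix_action_C_matrix entry_off)

lemma C_bounded:
  fixes x :: "nat \<Rightarrow> 'k::real_normed_field"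
  assumes "x \<in> ell2"
  shows "C x \<in> ell2"
    and "(\<Sum>i. (norm (C x i))\<^sup>2) \<le> bound * (\<Sum>i. (norm (x i))\<^sup>2)"
    and "(\<Sum>j<n. (norm (C x (N ^ Suc j)))\<^sup>2) \<le> (\<Sum>i. (norm (C x i))\<^sup>2)"
proof -
  let ?U = "\<lambda>j. (norm (C x (N ^ Suc j)))\<^sup>2"
  let ?X = "\<Sum>i. (norm (x i))\<^sup>2"
  have s: "1 < s" by (rule s_gt_1)
  have sx: "summable (\<lambda>i. (norm (x i))\<^sup>2)" using assms by (simp add: ell2_def)
  have le: "sum ?U {..n} \<le> bound * ?X" for n
  proof -
    have "(1 - 1 / s) * sum ?U {..n} \<le> (1 + 1 / s) * (\<Sum>i\<le>N ^ Suc n. (norm (x i))\<^sup>2)"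
    proof -
      have "0 \<le> 1 / s * ?U n" using s by simp
      then show ?thesis using C_partial_sums[where x = x and n = n] by linarith
    qed
    also have "\<dots> \<le> (1 + 1 / s) * ?X"
      using s sx by (intro mult_left_mono sum_le_suminf) auto
    finally have "sum ?U {..n} \<le> (1 + 1 / s) * ?X / (1 - 1 / s)"
      using s by (subst pos_le_divide_eq) (simp_all add: mult.commute)
    also have "(1 + 1 / s) / (1 - 1 / s) = bound"
      using s by (simp add: bound_def field_simps)
    then have "(1 + 1 / s) * ?X / (1 - 1 / s) = bound * ?X"
      by (metis times_divide_eq_left)
    finally show ?thesis .
  qed
  have sU: "summable ?U"
    by (rule bounded_imp_summable[OF _ le]) simp
  show ell: "C x \<in> ell2"
    unfolding ell2_def mem_Collect_eq
    using summable_mono_reindex[OF strict_mono_pow, of "\<lambda>i. (norm (C x i))\<^sup>2"] C_eq_0_off_powers sU by blast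
  have eq: "(\<Sum>i. (norm (C x i))\<^sup>2) = suminf ?U"
    using suminf_mono_reindex[OF strict_mono_pow, of "\<lambda>i. (norm (C x i))\<^sup>2"] C_eq_0_off_powers by metis
  have "suminf ?U \<le> bound * ?X"
  proof (rule suminf_le_const[OF sU])
    fix n show "sum ?U {..<n} \<le> bound * ?X"
      by (rule order_trans[OF sum_mono2 le[of n]]) auto
  qed
  then show "(\<Sum>i. (norm (C x i))\<^sup>2) \<le> bound * ?X" unfolding eq .
  show "sum ?U {..<n} \<le> (\<Sum>i. (norm (C x i))\<^sup>2)"
    unfolding eq using sU by (intro sum_le_suminf) auto
qed

lemma opnorm_le:
  "ell2_opnorm (C :: (nat \<Rightarrow> 'k::real_normed_field) \<Rightarrow> nat \<Rightarrow> 'k) \<le> ereal (sqrt bound)"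
  unfolding ell2_opnorm_def
proof (rule SUP_least)
  fix x :: "nat \<Rightarrow> 'k" assume x: "x \<in> ell2 - {\<lambda>_. 0}"
  have "(\<Sum>i. (norm (C x i))\<^sup>2) / (\<Sum>i. (norm (x i))\<^sup>2) \<le> bound"
    using C_bounded(2)[of x] suminf_norm_pos[OF x] x by (simp add: pos_divide_le_eq)
  then show "ell2_norm (C x) / ell2_norm x \<le> ereal (sqrt bound)"
    using C_bounded(1)[of x] x by (simp add: ell2_norm_quotient)
qed

section \<open>Lower bound\<close>

text \<open>On the block \<open>N ^ k < i \<le> N ^ (k+1)\<close> with \<open>k < n\<close> the value is \<open>1 / (s ^ k * (s + 1))\<close>, chosen so
  that the block adds \<open>s ^ (k+1) - s ^ k\<close> to the partial sums; the least exponent \<open>m\<close> in the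
  definition is \<open>k + 1\<close> there. Index \<open>0\<close> carries the partial sum \<open>1 = s ^ 0\<close> from which the
  telescoping starts, and index \<open>1\<close> carries nothing.\<close>

definition near_extremal :: "nat \<Rightarrow> nat \<Rightarrow> real" where
  "near_extremal n i =
    (if i = 0 then 1
     else if 1 < i \<and> i \<le> N ^ n then s / (s ^ (LEAST m. i \<le> N ^ m) * (s + 1))
     else 0)"

lemma near_extremal_block:
  assumes "k < n" "i \<in> {N ^ k<..N ^ Suc k}"
  shows "near_extremal n i = 1 / (s ^ k * (s + 1))"
proof -
  have least: "(LEAST m. i \<le> N ^ m) = Suc k"
  proof (rule Least_equality)
    show "i \<le> N ^ Suc k" using assms by simp
  next
    fix m assume "i \<le> N ^ m"
    with assms have "N ^ k < N ^ m" by simp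
    then show "Suc k \<le> m" using N_ge_2 by (simp add: power_strict_increasing_iff)
  qed
  have "N ^ Suc k \<le> N ^ n" using assms N_ge_2 by (intro power_increasing) auto
  moreover have "1 \<le> N ^ k" using N_ge_2 by simp
  ultimately have "1 < i" "i \<le> N ^ n" using assms by auto
  then show ?thesis
    using s_gt_1 by (simp add: near_extremal_def least)
qed

lemma N_minus_1: "real N - 1 = (s + 1) * (s - 1)"
  unfolding s_power2[symmetric] by (simp add: algebra_simps power2_eq_square)

lemma sum_near_extremal:
  assumes "k \<le> n"
  shows "(\<Sum>i\<le>N ^ k. near_extremal n i) = s ^ k"
  using assms
proof (induction k)
  case 0
  have "{..N ^ 0} = {0, 1}" by auto
  then show ?case by (simp add: near_extremal_def)
next
  case (Suc k)
  have "(\<Sum>i\<in>{N ^ k<..N ^ Suc k}. near_extremal n i)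
      = (s ^ k)\<^sup>2 * (real N - 1) * (1 / (s ^ k * (s + 1)))"
    using near_extremal_block[of k n] Suc.prems card_block[of k] by simp
  also have "\<dots> = s ^ Suc k - s ^ k"
  proof -
    have "(p * p) * (b * d) * (1 / (p * b)) = p * d" if "p \<noteq> 0" "b \<noteq> 0" for p b d :: real
      using that by (simp add: field_simps)
    from this[of "s ^ k" "s + 1" "s - 1"] show ?thesis
      unfolding N_minus_1 power2_eq_square using s_gt_1 by (simp add: algebra_simps)
  qed
  finally show ?case
    using Suc unfolding sum_upto_pow_Suc by simp
qed

text \<open>Every block carries the same energy, hence the energy grows linearly in the number of
  blocks, just as the energy of the image does.\<close>

lemma sum_near_extremal_squares:
  assumes "k \<le> n"
  shows "(\<Sum>i\<le>N ^ k. (near_extremal n i)\<^sup>2) = 1 + real k / bound"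
  using assms
proof (induction k)
  case 0
  have "{..N ^ 0} = {0, 1}" by auto
  then show ?case by (simp add: near_extremal_def)
next
  case (Suc k)
  have "(\<Sum>i\<in>{N ^ k<..N ^ Suc k}. (near_extremal n i)\<^sup>2)
      = (s ^ k)\<^sup>2 * (real N - 1) * (1 / (s ^ k * (s + 1)))\<^sup>2"
    using near_extremal_block[of k n] Suc.prems card_block[of k] by simp
  also have "\<dots> = 1 / bound"
  proof -
    have "(p * p) * (b * d) * (1 / (p * b) * (1 / (p * b))) = d / b" if "p \<noteq> 0" "b \<noteq> 0"
      for p b d :: real
      using that by (simp add: field_simps)
    from this[of "s ^ k" "s + 1" "s - 1"] show ?thesis
      unfolding N_minus_1 power2_eq_square bound_def using s_gt_1 by simp
  qed
  finally show ?case
    using Suc unfolding sum_upto_pow_Suc by (simp add: add_divide_distrib)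
qed

lemma opnorm_ge_quotient:
  "ereal (sqrt (real n / (1 + real n / bound)))
    \<le> ell2_opnorm (C :: (nat \<Rightarrow> 'k::real_normed_field) \<Rightarrow> nat \<Rightarrow> 'k)"
proof -
  define x :: "nat \<Rightarrow> 'k" where "x = (\<lambda>i. of_real (near_extremal n i))"
  have sq: "(norm (x i))\<^sup>2 = (near_extremal n i)\<^sup>2" for i by (simp add: x_def)
  have off: "(norm (x i))\<^sup>2 = 0" if "i \<notin> {..N ^ n}" for i
    using that unfolding sq by (simp add: near_extremal_def)
  have "x \<in> ell2" unfolding ell2_def mem_Collect_eq
    by (rule summable_finite[of "{..N ^ n}"]) (simp, rule off)
  moreover have "x 0 \<noteq> 0" by (simp add: x_def near_extremal_def)
  ultimately have x: "x \<in> ell2 - {\<lambda>_. 0}" by auto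
  have X: "(\<Sum>i. (norm (x i))\<^sup>2) = 1 + real n / bound"
    using suminf_finite[of "{..N ^ n}" "\<lambda>i. (norm (x i))\<^sup>2"] off
    by (simp add: sq sum_near_extremal_squares)
  have "norm (C x (N ^ Suc j)) = 1" if "j < n" for j
  proof -
    have "(\<Sum>i\<le>N ^ Suc j. x i) = of_real (s ^ Suc j)"
      using sum_near_extremal[of "Suc j" n] that unfolding x_def of_real_sum[symmetric] by simp
    then show ?thesis using s_gt_1 unfolding norm_C_pow by (simp only: norm_of_real) simp
  qed
  then have "(\<Sum>j<n. (norm (C x (N ^ Suc j)))\<^sup>2) = real n" by simp
  then have "real n \<le> (\<Sum>i. (norm (C x i))\<^sup>2)"
    using C_bounded(3)[where x = x and n = n] x by simp
  then have "ereal (sqrt (real n / (1 + real n / bound))) \<le> ell2_norm (C x) / ell2_norm x"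
    using ell2_norm_quotient[OF x C_bounded(1)] x bound_pos
    by (simp add: X divide_right_mono)
  also have "\<dots> \<le> ell2_opnorm (C :: (nat \<Rightarrow> 'k) \<Rightarrow> nat \<Rightarrow> 'k)"
    unfolding ell2_opnorm_def by (rule SUP_upper[OF x])
  finally show ?thesis .
qed

lemma opnorm_ge:
  "ereal (sqrt bound) \<le> ell2_opnorm (C :: (nat \<Rightarrow> 'k::real_normed_field) \<Rightarrow> nat \<Rightarrow> 'k)"
proof (rule LIMSEQ_le_const2)
  have "(\<lambda>n. real n / (1 + real n / bound)) \<longlonglongrightarrow> bound"
    using bound_pos by real_asymp
  then show "(\<lambda>n. ereal (sqrt (real n / (1 + real n / bound)))) \<longlonglongrightarrow> ereal (sqrt bound)"
    by (intro tendsto_ereal tendsto_real_sqrt)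
qed (use opnorm_ge_quotient in blast)

lemma sqrt_bound: "sqrt bound = sqrt (real N - 1) / (s - 1)"
proof -
  have "bound = (real N - 1) / (s - 1)\<^sup>2"
    unfolding N_minus_1 bound_def using s_gt_1 by (simp add: power2_eq_square)
  then show ?thesis using s_gt_1 by (simp add: real_sqrt_divide)
qed

end

section \<open>The norm\<close>

theorem theorem2p6:
  fixes N :: nat and a :: "nat \<Rightarrow> real"
  assumes "N \<ge> 2"
    and "\<And>j. j \<ge> 1 \<Longrightarrow> a (N ^ j) = 1 / real N powr (real j / 2)"
    and "\<And>n. \<not> (\<exists>j\<ge>1. n = N ^ j) \<Longrightarrow> a n = 0"
  shows "ell2_opnorm
           (matrix_action (C_matrix a) :: (nat \<Rightarrow> 'k::real_normed_field) \<Rightarrow> nat \<Rightarrow> 'k)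
         = ereal (sqrt (real N - 1) / (sqrt (real N) - 1))"
proof -
  interpret geometric_terraced N a
  proof
    show "2 \<le> N" by fact
    fix j
    have "real N powr (real (Suc j) / 2) = (real N powr (1 / 2)) powr real (Suc j)"
      by (simp add: powr_powr)
    also have "\<dots> = sqrt (real N) ^ Suc j"
      using assms(1) by (simp add: powr_half_sqrt powr_realpow del: of_nat_Suc power_Suc)
    finally show "a (N ^ Suc j) = 1 / sqrt (real N) ^ Suc j"
      using assms(2)[of "Suc j"] by simp
  next
    fix n assume "n \<notin> range (\<lambda>j. N ^ Suc j)"
    then have "\<not> (\<exists>j\<ge>1. n = N ^ j)"
      by (metis One_nat_def Suc_le_D rangeI)
    then show "a n = 0" by (rule assms(3))
  qed
  show ?thesis
    using opnorm_le opnorm_ge unfolding s_def[symmetric] sqrt_bound[symmetric] by (rule antisym)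
qed

end
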